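(* Let $f$ be a transcendental entire function. There exists $r(f)>0$ such that, whenever $r>0$ and $\alpha\in(0,1/2)$ satisfy $$\log M(r)\le r^{\alpha}\quad\text{and}\quad r^{1-2\alpha}\ge r(f),$$ there exists $t\in(r^{1-2\alpha},r)$ such that $$\log m(t)>\log M(r^{1-2\alpha})-2.$$
   Context: $M(r)=\max_{|z|=r}|f(z)|$ and $m(r)=\min_{|z|=r}|f(z)|$. *)

theory Defs
  imports "HOL-Analysis.Analysis" "HOL-Computational_Algebra.Polynomial"
begin

definition max_mod :: "(complex \<Rightarrow> complex) \<Rightarrow> real \<Rightarrow> real" where
  "max_mod f r = Sup ((\<lambda>z. norm (f z)) ` sphere 0 r)"

definition min_mod :: "(complex \<Rightarrow> complex) \<Rightarrow> real \<Rightarrow> real" where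
  "min_mod f r = Inf ((\<lambda>z. norm (f z)) ` sphere 0 r)"

definition transcendental_entire :: "(complex \<Rightarrow> complex) \<Rightarrow> bool" where
  "transcendental_entire f \<longleftrightarrow> f holomorphic_on UNIV \<and> \<not> (\<exists>p. \<forall>z. f z = poly p z)"

end

theory Submission
  imports Defs "HOL-Complex_Analysis.Conformal_Mappings"
begin

text \<open>
  Write \<open>a = r powr (1 - 2 * \<alpha>)\<close>, so that \<open>sqrt (r / a) = r powr \<alpha>\<close>, and suppose that the
  conclusion fails. Then every circle of radius \<open>t\<close> between \<open>a\<close> and \<open>r\<close> carries a point at which
  \<open>norm f\<close> is at most \<open>M(a)\<close>. Interpolate \<open>f\<close> at such points of moduli \<open>2 a + a k\<^sup>2 / 8\<close>,
  \<open>k \<le> n\<close>, where \<open>n\<close> is about \<open>sqrt (r / a)\<close>. Only the moduli of the nodes enter the bounds, as if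
  the nodes lay on the negative axis. With quadratically spaced nodes the Lagrange basis on the circle
  of radius \<open>2 a\<close> has an absolutely bounded Lebesgue constant, while the interpolation error is
  \<open>O(M(r) / 4 ^ n)\<close>, which is bounded because \<open>M(r) \<le> exp (sqrt (r / a))\<close>. Hence \<open>M(2 a) \<le> C M(a)\<close>
  with an absolute constant \<open>C\<close>, which is impossible for large \<open>a\<close> since \<open>f\<close> is transcendental.
\<close>

section \<open>Interpolation of entire functions\<close>

lemma entire_divide_linear:
  fixes f :: "complex \<Rightarrow> complex"
  assumes "f holomorphic_on UNIV"
  obtains g where "g holomorphic_on UNIV" "\<And>z. f z = f a + (z - a) * g z"
proof
  show "(\<lambda>z. if z = a then deriv f a else (f z - f a) / (z - a)) holomorphic_on UNIV"
    using pole_lemma_open[OF assms open_UNIV] .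
qed auto

text \<open>Zeros are split off one at a time; since the nodes are distinct, the quotient still
  vanishes at those that remain. This gives the interpolation error the form of the node polynomial
  times an entire function.\<close>

lemma entire_divide_prod:
  fixes f :: "complex \<Rightarrow> complex"
  assumes "finite I" "inj_on w I" "f holomorphic_on UNIV" "\<And>i. i \<in> I \<Longrightarrow> f (w i) = 0"
  shows "\<exists>g. g holomorphic_on UNIV \<and> (\<forall>z. f z = (\<Prod>i\<in>I. z - w i) * g z)"
  using assms
proof (induction I arbitrary: f rule: finite_induct)
  case empty
  then show ?case by auto
next
  case (insert a I)
  obtain h where h: "h holomorphic_on UNIV" "\<And>z. f z = f (w a) + (z - w a) * h z"
    using entire_divide_linear[OF insert.prems(2)] by blast
  have f: "f z = (z - w a) * h z" for z
    using h(2)[of z] insert.prems(3)[of a] by simp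
  have "h (w i) = 0" if "i \<in> I" for i
  proof -
    have "w i \<noteq> w a"
      using insert.prems(1) insert.hyps(2) that by (metis inj_onD insertCI)
    then show ?thesis
      using insert.prems(3)[of i] that f[of "w i"] by simp
  qed
  with insert.IH[OF _ h(1)] insert.prems(1)
  obtain g where "g holomorphic_on UNIV" "\<forall>z. h z = (\<Prod>i\<in>I. z - w i) * g z"
    by auto
  then show ?case
    using f insert.hyps by (intro exI[of _ g]) simp
qed

lemma entire_le_on_sphere:
  fixes f :: "complex \<Rightarrow> complex"
  assumes "f holomorphic_on UNIV" "\<And>z. norm z = r \<Longrightarrow> norm (f z) \<le> B" "norm z \<le> r" "r > 0"
  shows "norm (f z) \<le> B"
proof (rule maximum_modulus_frontier[of f "cball 0 r"])
  show "f holomorphic_on interior (cball 0 r)"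
    using assms(1) holomorphic_on_subset by blast
  show "continuous_on (closure (cball 0 r)) f"
    using holomorphic_on_imp_continuous_on[OF assms(1)] continuous_on_subset by blast
qed (use assms in \<open>auto simp: dist_norm\<close>)

text \<open>With \<open>L\<close> the Lagrange interpolant and \<open>\<omega>\<close> the node
  polynomial, \<open>f - L = \<omega> * g\<close> with \<open>g\<close> entire. At \<open>z\<close>
  the interpolant contributes \<open>\<mu> * \<Lambda>\<close>. The remainder is estimated on the
  circle of radius \<open>r\<close>, where \<open>f\<close> yields the term with \<open>M\<close>
  and \<open>L\<close> yields a further \<open>2 * \<mu> * \<Lambda>\<close>; hence the factor
  3.\<close>

lemma lagrange_bound:
  fixes f :: "complex \<Rightarrow> complex" and w :: "'i \<Rightarrow> complex"
  assumes fin: "finite I" and hol: "f holomorphic_on UNIV"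
    and inj: "inj_on (\<lambda>i. norm (w i)) I"
    and w_le: "\<And>i. i \<in> I \<Longrightarrow> norm (w i) \<le> r / 2"
    and f_w: "\<And>i. i \<in> I \<Longrightarrow> norm (f (w i)) \<le> \<mu>" and "\<mu> \<ge> 0"
    and M: "\<And>z. norm z = r \<Longrightarrow> norm (f z) \<le> M"
    and z: "norm z \<le> r / 2" and "r > 0"
  defines "\<Lambda> \<equiv> \<Sum>j\<in>I. \<Prod>k\<in>I-{j}. (norm z + norm (w k)) / \<bar>norm (w j) - norm (w k)\<bar>"
  shows "norm (f z) \<le> 3 * \<mu> * \<Lambda> + M * (\<Prod>k\<in>I. (norm z + norm (w k)) / (r / 2))"
proof -
  define l where "l j \<zeta> = (\<Prod>k\<in>I-{j}. (\<zeta> - w k) / (w j - w k))" for j \<zeta>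
  define L where "L \<zeta> = (\<Sum>j\<in>I. f (w j) * l j \<zeta>)" for \<zeta>
  define \<omega> where "\<omega> \<zeta> = (\<Prod>k\<in>I. \<zeta> - w k)" for \<zeta>
  define \<Lambda>' where "\<Lambda>' j = (\<Prod>k\<in>I-{j}. (norm z + norm (w k)) / \<bar>norm (w j) - norm (w k)\<bar>)" for j
  define Q where "Q = (\<Prod>k\<in>I. (norm z + norm (w k)) / (r / 2))"
  have inj': "inj_on w I"
    using inj by (auto simp: inj_on_def)
  have ne: "norm (w j) \<noteq> norm (w k)" if "j \<in> I" "k \<in> I - {j}" for j k
    using that inj by (auto simp: inj_on_def)
  have \<Lambda>'_nonneg: "\<Lambda>' j \<ge> 0" for j
    unfolding \<Lambda>'_def by (intro prod_nonneg) auto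
  have \<Lambda>: "\<Lambda> = (\<Sum>j\<in>I. \<Lambda>' j)"
    unfolding \<Lambda>_def \<Lambda>'_def ..
  have Q_nonneg: "Q \<ge> 0"
    unfolding Q_def using \<open>r > 0\<close> by (intro prod_nonneg) auto
  have M_nonneg: "M \<ge> 0"
    using order.trans[OF norm_ge_zero M[of "of_real r"]] \<open>r > 0\<close> by simp
  have l_node: "l j (w i) = (if i = j then 1 else 0)" if "i \<in> I" "j \<in> I" for i j
  proof (cases "i = j")
    case True
    have "(w i - w k) / (w j - w k) = 1" if "k \<in> I - {j}" for k
      using ne[OF \<open>j \<in> I\<close> that] True by auto
    then show ?thesis
      using True by (simp add: l_def)
  next
    case False
    then show ?thesis
      using that fin by (auto simp: l_def prod_zero_iff)
  qed
  have L_node: "L (w i) = f (w i)" if "i \<in> I" for i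
    using that fin by (simp add: L_def l_node if_distrib sum.delta cong: if_cong)
  have L_hol: "L holomorphic_on UNIV"
    unfolding L_def l_def by (intro holomorphic_intros) (use inj' in \<open>auto simp: inj_on_def\<close>)
  have "\<exists>g. g holomorphic_on UNIV \<and> (\<forall>z. f z - L z = (\<Prod>i\<in>I. z - w i) * g z)"
    using L_node by (intro entire_divide_prod[OF fin inj'] holomorphic_intros hol L_hol) auto
  then obtain g where g: "g holomorphic_on UNIV" and fL: "\<And>\<zeta>. f \<zeta> - L \<zeta> = \<omega> \<zeta> * g \<zeta>"
    unfolding \<omega>_def by blast
  \<comment> \<open>Only the denominators are replaced by differences of moduli. The numerators stay
    exact, so that on the outer circle they can cancel against
    \<open>\<omega> \<zeta>\<close>.\<close>
  have norm_l: "norm (l j \<zeta>) \<le> (\<Prod>k\<in>I-{j}. norm (\<zeta> - w k)) * (\<Prod>k\<in>I-{j}. 1 / \<bar>norm (w j) - norm (w k)\<bar>)"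
    if "j \<in> I" for j \<zeta>
    unfolding l_def prod_norm[symmetric] norm_divide prod.distrib[symmetric]
  proof (intro prod_mono conjI)
    fix k assume k: "k \<in> I - {j}"
    have "\<bar>norm (w j) - norm (w k)\<bar> \<le> norm (w j - w k)"
      by (rule norm_triangle_ineq3)
    then show "norm (\<zeta> - w k) / norm (w j - w k)
          \<le> norm (\<zeta> - w k) * (1 / \<bar>norm (w j) - norm (w k)\<bar>)"
      using ne[OF that k] by (auto intro!: divide_left_mono mult_pos_pos)
  qed auto
  have \<Lambda>'_eq: "\<Lambda>' j = (\<Prod>k\<in>I-{j}. norm z + norm (w k)) * (\<Prod>k\<in>I-{j}. 1 / \<bar>norm (w j) - norm (w k)\<bar>)" for j
    unfolding \<Lambda>'_def prod.distrib[symmetric] by simp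
  have norm_l_z: "norm (l j z) \<le> \<Lambda>' j" if "j \<in> I" for j
    unfolding \<Lambda>'_eq
    by (rule order.trans[OF norm_l[OF that] mult_right_mono])
       (auto intro!: prod_mono prod_nonneg norm_triangle_ineq4)
  have L_z: "norm (L z) \<le> \<mu> * \<Lambda>"
    unfolding L_def \<Lambda> sum_distrib_left
    by (rule sum_norm_le) (use norm_l_z f_w \<open>\<mu> \<ge> 0\<close> in \<open>auto simp: norm_mult intro!: mult_mono\<close>)
  define W where "W = (\<Prod>k\<in>I. norm z + norm (w k))"
  have W_nonneg: "W \<ge> 0"
    unfolding W_def by (intro prod_nonneg) auto
  have \<omega>_z: "norm (\<omega> z) \<le> W"
    unfolding \<omega>_def W_def prod_norm[symmetric] by (intro prod_mono) (auto intro: norm_triangle_ineq4)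
  have on_sphere: "norm (\<zeta> - w k) \<ge> r / 2" if "norm \<zeta> = r" "k \<in> I" for \<zeta> k
    using norm_triangle_ineq2[of \<zeta> "w k"] w_le[OF that(2)] that(1) by linarith
  \<comment> \<open>In the quotient of \<open>l j \<zeta>\<close> by \<open>\<omega> \<zeta>\<close>
    all factors with index other than \<open>j\<close> cancel. What is left is
    \<open>(norm z + norm (w j)) / norm (\<zeta> - w j)\<close>, at most
    \<open>r / (r / 2) = 2\<close>.\<close>
  have quot: "W * norm (l j \<zeta>) \<le> 2 * \<Lambda>' j * norm (\<omega> \<zeta>)" if "norm \<zeta> = r" "j \<in> I" for \<zeta> j
  proof -
    define P where "P = (\<Prod>k\<in>I-{j}. norm (\<zeta> - w k))"
    define D where "D = (\<Prod>k\<in>I-{j}. 1 / \<bar>norm (w j) - norm (w k)\<bar>)"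
    define V where "V = (\<Prod>k\<in>I-{j}. norm z + norm (w k))"
    have nn: "P \<ge> 0" "D \<ge> 0" "V \<ge> 0"
      unfolding P_def D_def V_def by (auto intro!: prod_nonneg)
    have W: "W = (norm z + norm (w j)) * V"
      unfolding W_def V_def using fin that(2) by (subst prod.remove) auto
    have \<omega>: "norm (\<omega> \<zeta>) = norm (\<zeta> - w j) * P"
      unfolding \<omega>_def P_def prod_norm[symmetric] using fin that(2) by (subst prod.remove) auto
    have "norm z + norm (w j) \<le> 2 * norm (\<zeta> - w j)"
      using z w_le[OF that(2)] on_sphere[OF that] by linarith
    then have "(norm z + norm (w j)) * (V * (P * D)) \<le> 2 * norm (\<zeta> - w j) * (V * (P * D))"
      using nn by (intro mult_right_mono) auto
    moreover have "W * norm (l j \<zeta>) \<le> W * (P * D)"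
      using norm_l[OF that(2)] W_nonneg unfolding P_def D_def by (intro mult_left_mono)
    ultimately show ?thesis
      unfolding W \<omega> \<Lambda>'_eq V_def[symmetric] D_def[symmetric] by (simp add: algebra_simps)
  qed
  txt \<open>The factor \<open>W\<close> dominates \<open>\<omega> z\<close> for the given \<open>z\<close> only, so the maximum principle is applied
    to \<open>W * g\<close>; on the outer circle \<open>g = (f - L) / \<omega>\<close>.\<close>
  have "norm (of_real W * g z) \<le> 2 * \<mu> * \<Lambda> + M * Q"
  proof (rule entire_le_on_sphere[where f = "\<lambda>z. of_real W * g z" and r = r])
    fix \<zeta> :: complex assume \<zeta>: "norm \<zeta> = r"
    have \<omega>_pos: "norm (\<omega> \<zeta>) > 0"
      unfolding \<omega>_def prod_norm[symmetric] using on_sphere[OF \<zeta>] \<open>r > 0\<close> by (intro prod_pos) force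
    have "Q * (\<Prod>k\<in>I. r / 2) = W"
      unfolding Q_def W_def prod.distrib[symmetric] using \<open>r > 0\<close> by (intro prod.cong) auto
    moreover have "(\<Prod>k\<in>I. r / 2) \<le> norm (\<omega> \<zeta>)"
      unfolding \<omega>_def prod_norm[symmetric] using on_sphere[OF \<zeta>] \<open>r > 0\<close> by (intro prod_mono) auto
    ultimately have "W \<le> Q * norm (\<omega> \<zeta>)"
      using Q_nonneg by (metis mult_left_mono)
    then have 1: "W * norm (f \<zeta>) \<le> (Q * norm (\<omega> \<zeta>)) * M"
      using M[OF \<zeta>] Q_nonneg W_nonneg by (intro mult_mono) auto
    have "W * norm (L \<zeta>) \<le> W * (\<Sum>j\<in>I. \<mu> * norm (l j \<zeta>))"
      unfolding L_def using f_w
      by (intro mult_left_mono[OF sum_norm_le W_nonneg]) (auto simp: norm_mult intro!: mult_right_mono)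
    also have "\<dots> = (\<Sum>j\<in>I. \<mu> * (W * norm (l j \<zeta>)))"
      by (simp add: sum_distrib_left algebra_simps)
    also have "\<dots> \<le> (\<Sum>j\<in>I. \<mu> * (2 * \<Lambda>' j * norm (\<omega> \<zeta>)))"
      using quot[OF \<zeta>] \<open>\<mu> \<ge> 0\<close> by (intro sum_mono mult_left_mono) auto
    also have "\<dots> = (2 * \<mu> * \<Lambda>) * norm (\<omega> \<zeta>)"
      by (simp add: \<Lambda> sum_distrib_left sum_distrib_right algebra_simps)
    finally have 2: "W * norm (L \<zeta>) \<le> (2 * \<mu> * \<Lambda>) * norm (\<omega> \<zeta>)" .
    have "W * (norm (\<omega> \<zeta>) * norm (g \<zeta>)) = W * norm (f \<zeta> - L \<zeta>)"
      by (simp add: fL norm_mult)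
    also have "\<dots> \<le> W * (norm (f \<zeta>) + norm (L \<zeta>))"
      using W_nonneg by (intro mult_left_mono norm_triangle_ineq4)
    also have "\<dots> \<le> (2 * \<mu> * \<Lambda> + M * Q) * norm (\<omega> \<zeta>)"
      using 1 2 by (simp add: algebra_simps)
    finally have "(W * norm (g \<zeta>)) * norm (\<omega> \<zeta>) \<le> (2 * \<mu> * \<Lambda> + M * Q) * norm (\<omega> \<zeta>)"
      by (simp add: algebra_simps)
    then show "norm (of_real W * g \<zeta>) \<le> 2 * \<mu> * \<Lambda> + M * Q"
      using \<omega>_pos W_nonneg by (simp add: norm_mult)
  qed (use g z \<open>r > 0\<close> in \<open>auto intro!: holomorphic_intros\<close>)
  moreover have "norm (\<omega> z * g z) \<le> norm (of_real W * g z)"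
    using \<omega>_z W_nonneg by (auto simp: norm_mult intro!: mult_right_mono)
  moreover have "norm (f z) \<le> norm (L z) + norm (\<omega> z * g z)"
    using norm_triangle_ineq[of "L z" "f z - L z"] unfolding fL[symmetric] by simp
  ultimately show ?thesis
    using L_z unfolding Q_def by linarith
qed

section \<open>Products over squares of integers\<close>

text \<open>Factoring each term as \<open>(j - k) * (j + k)\<close> gives the quotients
  \<open>j! / (j - m)!\<close> and \<open>(j + m - 1)! / (j - 1)!\<close>. Denominators are cleared,
  and the factor \<open>j + m\<close> completes \<open>(j + m)!\<close>, so that no predecessor
  appears.\<close>

lemma prod_square_diff_lessThan:
  assumes "m \<le> j"
  shows "(\<Prod>k<m. (real j)\<^sup>2 - (real k)\<^sup>2) * fact (j - m) * real (j + m) = real j * fact (j + m)"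
  using assms
proof (induction m)
  case (Suc m)
  have "Suc (j - Suc m) = j - m"
    using Suc.prems by simp
  then have fact: "(fact (j - m) :: real) = real (j - m) * fact (j - Suc m)"
    by (metis fact_Suc)
  have diff: "(real j)\<^sup>2 - (real m)\<^sup>2 = real (j - m) * real (j + m)"
    using Suc.prems by (simp add: of_nat_diff power2_eq_square algebra_simps)
  have "(\<Prod>k<Suc m. (real j)\<^sup>2 - (real k)\<^sup>2) * fact (j - Suc m) * real (j + Suc m)
      = ((\<Prod>k<m. (real j)\<^sup>2 - (real k)\<^sup>2) * fact (j - m) * real (j + m)) * real (j + Suc m)"
    unfolding fact prod.lessThan_Suc diff by (simp only: ac_simps)
  also have "\<dots> = (real j * fact (j + m)) * real (j + Suc m)"
    using Suc by simp
  finally show ?case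
    by simp
qed (simp add: algebra_simps)

text \<open>The induction starts at \<open>n = j\<close>, where the preceding identity with
  \<open>m = j\<close> applies after cancelling \<open>j\<close>. The case \<open>j = 0\<close> is
  excluded because its product is already \<open>(n!)^2\<close>, without the factor 2.\<close>

lemma prod_abs_square_diff:
  assumes "0 < j" "j \<le> n"
  shows "2 * (\<Prod>k\<in>{..n}-{j}. \<bar>(real j)\<^sup>2 - (real k)\<^sup>2\<bar>) = fact (n - j) * fact (n + j)"
  using assms(2)
proof (induction n rule: dec_induct)
  case base
  have "{..j} - {j} = {..<j}" by auto
  then have "(\<Prod>k\<in>{..j}-{j}. \<bar>(real j)\<^sup>2 - (real k)\<^sup>2\<bar>) = (\<Prod>k<j. (real j)\<^sup>2 - (real k)\<^sup>2)"
    by (auto intro!: prod.cong simp: power_mono)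
  then show ?case
    using prod_square_diff_lessThan[of j j] assms(1) by (simp add: algebra_simps)
next
  case (step n)
  have "{..Suc n} - {j} = insert (Suc n) ({..n} - {j})"
    using step.hyps by auto
  then have "2 * (\<Prod>k\<in>{..Suc n}-{j}. \<bar>(real j)\<^sup>2 - (real k)\<^sup>2\<bar>)
      = \<bar>(real j)\<^sup>2 - (real (Suc n))\<^sup>2\<bar> * (fact (n - j) * fact (n + j))"
    using step.IH by simp
  also have "\<bar>(real j)\<^sup>2 - (real (Suc n))\<^sup>2\<bar> = real (Suc n - j) * real (Suc n + j)"
    using step.hyps power_mono[of "real j" "real (Suc n)" 2]
    by (simp add: of_nat_diff power2_eq_square algebra_simps)
  also have "\<dots> * (fact (n - j) * fact (n + j)) = fact (Suc n - j) * fact (Suc n + j)"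
    using step.hyps by (simp add: Suc_diff_le algebra_simps)
  finally show ?case .
qed

text \<open>The central binomial coefficient is the largest in row \<open>2 * n\<close>; compare it
  with the one at \<open>n - j\<close>.\<close>

lemma fact_square_le: 
  assumes "j \<le> n"
  shows "(fact n)\<^sup>2 \<le> (fact (n - j) * fact (n + j) :: real)"
proof -
  have "real (2 * n choose (n - j)) \<le> real (2 * n choose n)"
    using binomial_maximum' of_nat_mono by blast
  moreover have "2 * n - (n - j) = n + j"
    using assms by simp
  ultimately have "fact (2 * n) / (fact (n - j) * fact (n + j)) \<le> (fact (2 * n) / (fact n * fact n) :: real)"
    by (simp add: binomial_fact)
  then show ?thesis
    by (simp add: field_simps power2_eq_square)
qed

text \<open>A lower bound for the Lagrange denominators that is uniform in the node
  \<open>j\<close>; it rests on the quadratic spacing.\<close>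

lemma fact_square_le_prod_abs_square_diff:
  assumes "j \<le> n"
  shows "(fact n)\<^sup>2 \<le> 2 * (\<Prod>k\<in>{..n}-{j}. \<bar>(real j)\<^sup>2 - (real k)\<^sup>2\<bar>)"
proof (cases "j = 0")
  case True
  have "{..n} - {0} = {1..n}" by auto
  then have "(\<Prod>k\<in>{..n}-{0}. \<bar>(real 0)\<^sup>2 - (real k)\<^sup>2\<bar>) = (fact n)\<^sup>2"
    by (simp add: fact_prod prod_power_distrib)
  then show ?thesis
    using True by simp
next
  case False
  then show ?thesis
    using prod_abs_square_diff[of j n] fact_square_le[of j n] assms by simp
qed

lemma sum_inverse_squares_le: "(\<Sum>k=1..n. 1 / (real k)\<^sup>2) \<le> 2"
proof -
  \<comment> \<open>The sharper bound lets the induction telescope. At \<open>n = 0\<close> the term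
    \<open>1 / real n\<close> is 0, so the step from 0 to 1 is treated separately.\<close>
  have "(\<Sum>k=1..n. 1 / (real k)\<^sup>2) \<le> 2 - 1 / real n"
  proof (induction n)
    case (Suc n)
    have "1 / (real (Suc n))\<^sup>2 \<le> 1 / real n - 1 / real (Suc n)" if "n > 0"
    proof -
      have "1 / (real (Suc n))\<^sup>2 \<le> 1 / (real n * real (Suc n))"
        using that by (intro divide_left_mono) (auto simp: power2_eq_square)
      also have "\<dots> = 1 / real n - 1 / real (Suc n)"
        using that by (simp add: field_simps)
      finally show ?thesis .
    qed
    with Suc show ?case by (cases "n = 0") auto
  qed simp
  also have "\<dots> \<le> 2" by simp
  finally show ?thesis .
qed

text \<open>After \<open>k^2\<close> is taken out of each factor, \<open>1 + x \<le> exp x\<close>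
  turns the product into the exponential of \<open>c\<close> times the sum of inverse
  squares.\<close>

lemma prod_add_squares_le:
  assumes "c \<ge> 0"
  shows "(\<Prod>k=1..n. c + (real k)\<^sup>2) \<le> exp (2 * c) * (fact n)\<^sup>2"
proof -
  have "(\<Prod>k=1..n. c + (real k)\<^sup>2) = (\<Prod>k=1..n. (1 + c / (real k)\<^sup>2) * (real k)\<^sup>2)"
    by (intro prod.cong) (auto simp: field_simps)
  also have "\<dots> = (\<Prod>k=1..n. 1 + c / (real k)\<^sup>2) * (fact n)\<^sup>2"
    by (simp add: prod.distrib fact_prod prod_power_distrib)
  also have "(\<Prod>k=1..n. 1 + c / (real k)\<^sup>2) \<le> (\<Prod>k=1..n. exp (c / (real k)\<^sup>2))"
    using assms by (intro prod_mono) (auto intro: add_nonneg_nonneg)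
  also have "\<dots> = exp (c * (\<Sum>k=1..n. 1 / (real k)\<^sup>2))"
    by (simp add: exp_sum sum_distrib_left)
  also have "\<dots> \<le> exp (2 * c)"
    using mult_left_mono[OF sum_inverse_squares_le[of n] assms] by simp
  finally show ?thesis
    by (simp add: mult_right_mono)
qed

section \<open>Maximum and minimum modulus\<close>

lemma compact_norm_image_sphere:
  fixes f :: "complex \<Rightarrow> complex"
  assumes "f holomorphic_on UNIV"
  shows "compact ((\<lambda>z. norm (f z)) ` sphere 0 r)"
  by (intro compact_continuous_image continuous_intros
      continuous_on_subset[OF holomorphic_on_imp_continuous_on[OF assms]]) auto

lemma norm_le_max_mod:
  assumes "f holomorphic_on UNIV"
  shows "norm (f z) \<le> max_mod f (norm z)"
  unfolding max_mod_def
  by (intro cSup_upper bounded_imp_bdd_above[OF compact_imp_bounded[OF compact_norm_image_sphere[OF assms]]]) auto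

lemma max_mod_attained:
  assumes "f holomorphic_on UNIV" "r \<ge> 0"
  obtains z where "norm z = r" "norm (f z) = max_mod f r"
proof -
  have ne: "(\<lambda>z. norm (f z)) ` sphere 0 r \<noteq> {}"
    using assms(2) by simp
  from compact_imp_closed[OF compact_norm_image_sphere[OF assms(1)]]
  have "max_mod f r \<in> (\<lambda>z. norm (f z)) ` sphere 0 r"
    unfolding max_mod_def
    using closed_contains_Sup[OF ne bounded_imp_bdd_above[OF compact_imp_bounded[OF compact_norm_image_sphere[OF assms(1)]]]] by blast
  with that show ?thesis by auto
qed

lemma min_mod_attained:
  assumes "f holomorphic_on UNIV" "r \<ge> 0"
  obtains z where "norm z = r" "norm (f z) = min_mod f r"
proof -
  have ne: "(\<lambda>z. norm (f z)) ` sphere 0 r \<noteq> {}"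
    using assms(2) by simp
  from compact_imp_closed[OF compact_norm_image_sphere[OF assms(1)]]
  have "min_mod f r \<in> (\<lambda>z. norm (f z)) ` sphere 0 r"
    unfolding min_mod_def
    using closed_contains_Inf[OF ne bounded_imp_bdd_below[OF compact_imp_bounded[OF compact_norm_image_sphere[OF assms(1)]]]] by blast
  with that show ?thesis by auto
qed

lemma norm_le_max_mod_of_norm_le:
  assumes "f holomorphic_on UNIV" "norm z \<le> r" "r > 0"
  shows "norm (f z) \<le> max_mod f r"
  using entire_le_on_sphere[OF assms(1) _ assms(2,3)] norm_le_max_mod[OF assms(1)] by metis

lemma max_mod_mono:
  assumes "f holomorphic_on UNIV" "0 \<le> r" "r \<le> s" "0 < s"
  shows "max_mod f r \<le> max_mod f s"
  using max_mod_attained[OF assms(1,2)] norm_le_max_mod_of_norm_le[OF assms(1) _ assms(4)] assms(3) by metis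

section \<open>Growth of transcendental entire functions\<close>

text \<open>Here \<open>p\<close> is the Taylor polynomial of degree below \<open>N\<close>,
  obtained by splitting off the value at 0 repeatedly. The degree bound is expressed through growth:
  \<open>p\<close> is \<open>O(norm z ^ (N - 1))\<close>, written with a factor
  \<open>norm z\<close> on the left so that \<open>N = 0\<close> fits.\<close>

lemma entire_split_poly:
  fixes f :: "complex \<Rightarrow> complex"
  assumes "f holomorphic_on UNIV"
  shows "\<exists>p g K. g holomorphic_on UNIV \<and> (\<forall>z. f z = poly p z + z ^ N * g z) \<and> K \<ge> 0 \<and>
           (\<forall>z. norm z \<ge> 1 \<longrightarrow> norm z * norm (poly p z) \<le> K * norm z ^ N)"
  using assms
proof (induction N arbitrary: f)
  case 0
  then show ?case
    by (intro exI[of _ 0] exI[of _ f]) auto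
next
  case (Suc N)
  obtain h where h: "h holomorphic_on UNIV" "\<And>z. f z = f 0 + (z - 0) * h z"
    using entire_divide_linear[OF Suc.prems] by blast
  obtain p g K where IH: "g holomorphic_on UNIV" "\<And>z. h z = poly p z + z ^ N * g z" "K \<ge> 0"
      "\<And>z. norm z \<ge> 1 \<Longrightarrow> norm z * norm (poly p z) \<le> K * norm z ^ N"
    using Suc.IH[OF h(1)] by blast
  have "norm z * norm (poly (pCons (f 0) p) z) \<le> (norm (f 0) + K) * norm z ^ Suc N"
    if "norm z \<ge> 1" for z
  proof -
    have "norm z * norm (f 0 + z * poly p z) \<le> norm z * (norm (f 0) + norm z * norm (poly p z))"
      by (intro mult_left_mono) (use norm_triangle_ineq[of "f 0" "z * poly p z"] in \<open>auto simp: norm_mult\<close>)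
    moreover have "norm z * (norm z * norm (poly p z)) \<le> norm z * (K * norm z ^ N)"
      using IH(4)[OF that] by (intro mult_left_mono) auto
    moreover have "norm (f 0) * norm z \<le> norm (f 0) * norm z ^ Suc N"
      using that by (intro mult_left_mono) (simp_all add: self_le_power del: power_Suc)
    ultimately show ?thesis
      by (simp add: algebra_simps)
  qed
  moreover have "f z = poly (pCons (f 0) p) z + z ^ Suc N * g z" for z
    using h(2)[of z] IH(2)[of z] by (simp add: algebra_simps)
  moreover have "norm (f 0) + K \<ge> 0"
    using IH(3) by simp
  ultimately show ?case
    using IH(1) by blast
qed

text \<open>In \<open>f z = poly p z + z ^ N * g z\<close> the second term dominates for large
  \<open>r\<close>, and doubling \<open>r\<close> multiplies it by at least about
  \<open>2 ^ N\<close>. Since \<open>f\<close> is not a polynomial, \<open>N\<close> may be as large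
  as desired.\<close>

lemma transcendental_max_mod_growth:
  assumes "transcendental_entire f" "C > 0" "B > 0"
  shows "\<exists>R\<ge>1. \<forall>r\<ge>R. max_mod f r \<ge> B \<and> max_mod f (2 * r) > C * max_mod f r"
proof -
  have hol: "f holomorphic_on UNIV" and not_poly: "\<nexists>p. \<forall>z. f z = poly p z"
    using assms(1) by (auto simp: transcendental_entire_def)
  \<comment> \<open>\<open>2 ^ n\<close> absorbs \<open>C\<close> and the crude factor 2 in the
    upper bound for \<open>max_mod f r\<close>; the additional factor 2 in \<open>2 ^ N\<close> pays
    for the polynomial part.\<close>
  obtain n where n: "2 * C < 2 ^ n"
    using real_arch_pow[of 2 "2 * C"] by auto
  define N where "N = Suc n"
  obtain p g K where g: "g holomorphic_on UNIV" and f: "\<And>z. f z = poly p z + z ^ N * g z"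
      and "K \<ge> 0" and p: "\<And>z. norm z \<ge> 1 \<Longrightarrow> norm z * norm (poly p z) \<le> K * norm z ^ N"
    using entire_split_poly[OF hol] by metis
  \<comment> \<open>If \<open>g\<close> vanished identically, \<open>f\<close> would equal the
    polynomial \<open>p\<close>.\<close>
  obtain z0 where z0: "g z0 \<noteq> 0"
    using f not_poly by force
  define c where "c = norm (g z0)"
  have "c > 0"
    using z0 by (simp add: c_def)
  have p': "norm (poly p z) \<le> r ^ N * (max_mod g r / 3)"
    if "norm z = r'" "r' \<ge> r" "r' \<le> 2 * r" "r \<ge> 1" "r \<ge> norm z0" "r \<ge> 3 * 2 ^ N * K / c" for z r r'
  proof -
    have "norm (poly p z) \<le> K * r' ^ N / r'"
      using p[of z] that by (simp add: field_simps)
    also have "\<dots> \<le> K * (2 * r) ^ N / r"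
      using that \<open>K \<ge> 0\<close> by (intro frac_le mult_left_mono power_mono) auto
    also have "\<dots> = r ^ N * (2 ^ N * K / r)"
      by (simp add: power_mult_distrib)
    also have "2 ^ N * K / r \<le> c / 3"
      using that \<open>c > 0\<close> by (simp add: field_simps)
    also have "c \<le> max_mod g r"
      unfolding c_def using that by (intro norm_le_max_mod_of_norm_le[OF g]) auto
    finally show ?thesis
      using that by (simp add: mult_left_mono)
  qed
  \<comment> \<open>The entries ensure in turn: the growth bound on \<open>p\<close> applies;
    \<open>max_mod g r \<ge> c\<close>; \<open>p\<close> is at most a third of the main term on
    radii from \<open>r\<close> to \<open>2 * r\<close>; and two thirds of the main term reach
    \<open>B\<close>.\<close>
  define R where "R = Max {1, norm z0, 3 * 2 ^ N * K / c, 3 * B / (2 * c)}"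
  have "max_mod f r \<ge> B \<and> max_mod f (2 * r) > C * max_mod f r" if "r \<ge> R" for r
  proof -
    have r: "r \<ge> 1" "r \<ge> norm z0" "r \<ge> 3 * 2 ^ N * K / c" "r \<ge> 3 * B / (2 * c)"
      using that unfolding R_def by auto
    define G where "G = max_mod g r"
    have "c \<le> G"
      unfolding c_def G_def using r by (intro norm_le_max_mod_of_norm_le[OF g]) auto
    have lower: "max_mod f r' \<ge> r' ^ N * G - r ^ N * (G / 3)" if r': "r' \<ge> r" "r' \<le> 2 * r" for r'
    proof -
      have "r' \<ge> 0" using r r' by linarith
      obtain z where z: "norm z = r'" "norm (g z) = max_mod g r'"
        using max_mod_attained[OF g \<open>r' \<ge> 0\<close>] .
      have "r' ^ N * G \<le> norm (z ^ N * g z)"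
        using z r r' max_mod_mono[OF g, of r r'] by (auto simp: norm_mult norm_power G_def intro!: mult_left_mono)
      also have "\<dots> \<le> norm (f z) + norm (poly p z)"
        using norm_triangle_ineq4[of "f z" "poly p z"] by (simp add: f)
      finally show ?thesis
        using norm_le_max_mod[OF hol, of z] p'[OF z(1) r' r(1-3)] z(1) by (simp add: G_def)
    qed
    have upper: "max_mod f r \<le> r ^ N * G + r ^ N * (G / 3)"
    proof -
      obtain z where z: "norm z = r" "norm (f z) = max_mod f r"
        using max_mod_attained[OF hol, of r] r by auto
      have "norm (z ^ N * g z) \<le> r ^ N * G"
        using z r norm_le_max_mod[OF g, of z] by (auto simp: norm_mult norm_power G_def intro!: mult_left_mono)
      moreover have "norm (poly p z) \<le> r ^ N * (G / 3)"
        unfolding G_def using p'[OF z(1) _ _ r(1-3)] r by auto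
      moreover have "norm (f z) \<le> norm (poly p z) + norm (z ^ N * g z)"
        unfolding f by (rule norm_triangle_ineq)
      ultimately show ?thesis
        using z(2) by linarith
    qed
    have "r ^ 1 \<le> r ^ N"
      using r by (intro power_increasing) (auto simp: N_def)
    then have "3 * B / (2 * c) * c \<le> r ^ N * G"
      using r \<open>c > 0\<close> \<open>c \<le> G\<close> by (intro mult_mono) auto
    then have "B \<le> r ^ N * G - r ^ N * (G / 3)"
      using \<open>c > 0\<close> by (simp add: mult.commute)
    then have "max_mod f r \<ge> B"
      using lower[of r] r by linarith
    have "C * max_mod f r \<le> C * (2 * (r ^ N * G))"
    proof (intro mult_left_mono)
      have "r ^ N * G \<ge> 0"
        using r \<open>c \<le> G\<close> \<open>c > 0\<close> by simp
      then show "max_mod f r \<le> 2 * (r ^ N * G)"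
        using upper by linarith
    qed (use \<open>C > 0\<close> in simp)
    also have "\<dots> < 2 ^ n * (r ^ N * G)"
      using n r \<open>c \<le> G\<close> \<open>c > 0\<close> by (simp add: mult_strict_right_mono)
    also have "\<dots> \<le> (2 * r) ^ N * G - r ^ N * (G / 3)"
    proof -
      have "1 * (r ^ N * G) \<le> 2 ^ n * (r ^ N * G)"
        using r \<open>c \<le> G\<close> \<open>c > 0\<close> by (intro mult_right_mono) auto
      moreover have "(2 * r) ^ N * G = 2 * (2 ^ n * (r ^ N * G))"
        by (simp add: N_def power_mult_distrib)
      moreover have "r ^ N * G \<ge> 0"
        using r \<open>c \<le> G\<close> \<open>c > 0\<close> by simp
      ultimately show ?thesis by linarith
    qed
    also have "\<dots> \<le> max_mod f (2 * r)"
      using lower[of "2 * r"] r by simp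
    finally show ?thesis
      using \<open>max_mod f r \<ge> B\<close> by simp
  qed
  moreover have "R \<ge> 1"
    by (simp add: R_def)
  ultimately show ?thesis by blast
qed

section \<open>Interpolation at quadratically spaced moduli\<close>

lemma prod_add_squares_atMost_le:
  assumes "c \<ge> 0"
  shows "(\<Prod>k\<le>n. c + (real k)\<^sup>2) \<le> c * (exp (2 * c) * (fact n)\<^sup>2)"
proof -
  have "{..n} = insert 0 {1..n}" by auto
  then have "(\<Prod>k\<le>n. c + (real k)\<^sup>2) = c * (\<Prod>k=1..n. c + (real k)\<^sup>2)"
    by simp
  then show ?thesis
    using prod_add_squares_le[OF assms, of n] assms by (simp add: mult_left_mono)
qed

text \<open>Completing the numerator by its missing factor \<open>c + j^2\<close> bounds the
  \<open>j\<close>-th product by \<open>2 * exp (2 * c) * c / (c + j^2)\<close>. These bounds are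
  summable, so the result does not depend on \<open>n\<close>.\<close>

lemma lebesgue_sum_le:
  fixes c :: real
  assumes "c > 0"
  shows "(\<Sum>j\<le>n. \<Prod>k\<in>{..n}-{j}. (c + (real k)\<^sup>2) / \<bar>(real j)\<^sup>2 - (real k)\<^sup>2\<bar>)
           \<le> 2 * exp (2 * c) * (1 + 2 * c)"
proof -
  have "(\<Prod>k\<in>{..n}-{j}. (c + (real k)\<^sup>2) / \<bar>(real j)\<^sup>2 - (real k)\<^sup>2\<bar>)
          \<le> 2 * exp (2 * c) * (c / (c + (real j)\<^sup>2))" if "j \<le> n" for j
  proof -
    have pos: "c + (real j)\<^sup>2 > 0"
      using assms by (simp add: add_pos_nonneg)
    define P where "P = (\<Prod>k\<in>{..n}-{j}. c + (real k)\<^sup>2)"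
    define D where "D = (\<Prod>k\<in>{..n}-{j}. \<bar>(real j)\<^sup>2 - (real k)\<^sup>2\<bar>)"
    have D: "(fact n)\<^sup>2 \<le> 2 * D"
      unfolding D_def by (rule fact_square_le_prod_abs_square_diff[OF that])
    have "D > 0"
      using less_le_trans[OF _ D, of 0] by simp
    have "(c + (real j)\<^sup>2) * P = (\<Prod>k\<le>n. c + (real k)\<^sup>2)"
      unfolding P_def using that by (subst (2) prod.remove[of _ j]) auto
    also have "\<dots> \<le> c * (exp (2 * c) * (fact n)\<^sup>2)"
      using assms by (intro prod_add_squares_atMost_le) simp
    also have "\<dots> \<le> c * (exp (2 * c) * (2 * D))"
      using D assms by (intro mult_left_mono) auto
    finally have "P \<le> 2 * exp (2 * c) * (c / (c + (real j)\<^sup>2)) * D"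
      using pos by (simp add: pos_le_divide_eq algebra_simps)
    then have "P / D \<le> 2 * exp (2 * c) * (c / (c + (real j)\<^sup>2))"
      using \<open>D > 0\<close> by (simp add: pos_divide_le_eq)
    then show ?thesis
      by (simp add: prod_dividef P_def D_def)
  qed
  then have "(\<Sum>j\<le>n. \<Prod>k\<in>{..n}-{j}. (c + (real k)\<^sup>2) / \<bar>(real j)\<^sup>2 - (real k)\<^sup>2\<bar>)
      \<le> 2 * exp (2 * c) * (\<Sum>j\<le>n. c / (c + (real j)\<^sup>2))"
    unfolding sum_distrib_left by (intro sum_mono) auto
  also have "(\<Sum>j\<le>n. c / (c + (real j)\<^sup>2)) \<le> 1 + 2 * c"
  proof -
    have "{..n} = insert 0 {1..n}" by auto
    then have "(\<Sum>j\<le>n. c / (c + (real j)\<^sup>2)) = 1 + (\<Sum>j=1..n. c / (c + (real j)\<^sup>2))"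
      using assms by simp
    also have "(\<Sum>j=1..n. c / (c + (real j)\<^sup>2)) \<le> (\<Sum>j=1..n. c * (1 / (real j)\<^sup>2))"
      using assms by (intro sum_mono) (auto intro!: divide_left_mono mult_pos_pos add_pos_pos)
    also have "\<dots> \<le> c * 2"
      unfolding sum_distrib_left[symmetric] using assms
      by (intro mult_left_mono sum_inverse_squares_le) auto
    finally show ?thesis by simp
  qed
  finally show ?thesis
    by simp
qed

text \<open>The constants come from \<open>lagrange_bound\<close> and \<open>lebesgue_sum_le\<close>
  with \<open>c = 32\<close>: \<open>390 = 3 * 2 * (1 + 2 * 32)\<close>, and the 4 bounds the
  remainder after \<open>exp 64\<close> is taken out.\<close>

lemma entire_bound_of_small_points:
  fixes f :: "complex \<Rightarrow> complex"
  assumes hol: "f holomorphic_on UNIV" and "a > 0" and r: "16 * a \<le> r"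
    and small: "\<And>t. a < t \<Longrightarrow> t < r \<Longrightarrow> \<exists>w. norm w = t \<and> norm (f w) \<le> \<mu>" and "\<mu> \<ge> 0"
    and M: "\<And>w. norm w = r \<Longrightarrow> norm (f w) \<le> exp (sqrt (r / a))"
    and z: "norm z = 2 * a"
  shows "norm (f z) \<le> exp 64 * (390 * \<mu> + 4)"
proof -
  define X where "X = r / a"
  define n where "n = nat \<lfloor>sqrt X\<rfloor>"
  \<comment> \<open>The nodes stay in the inner half of the disc because
    \<open>2 * a \<le> r / 8\<close> and \<open>n^2 \<le> r / a\<close>. The step
    \<open>a / 8\<close> is small enough for the error to decay like \<open>4 ^ -n\<close>, which
    beats the growth \<open>exp (sqrt X)\<close>.\<close>
  define t where "t k = 2 * a + a / 8 * (real k)\<^sup>2" for k :: nat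
  have X: "X \<ge> 16" "r = a * X"
    using r \<open>a > 0\<close> by (auto simp: X_def field_simps)
  have n_le: "real n \<le> sqrt X" and le_n: "sqrt X \<le> real n + 1"
    using X by (auto simp: n_def of_nat_nat)
  have n2: "(real n)\<^sup>2 \<le> X"
    using power_mono[OF n_le, of 2] X by simp
  have t_gt: "a < t k" for k
    using \<open>a > 0\<close> by (auto simp: t_def intro: add_pos_nonneg less_le_trans[of _ "2 * a"])
  have t_le: "t k \<le> r / 2" if "k \<le> n" for k
  proof -
    have "(real k)\<^sup>2 \<le> X"
      using power_mono[of "real k" "real n" 2] that n2 by linarith
    then have "a * (2 + (real k)\<^sup>2 / 8) \<le> a * (X / 2)"
      using X \<open>a > 0\<close> by (intro mult_left_mono) auto
    then show ?thesis
      by (simp add: t_def X(2) algebra_simps)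
  qed
  have "r > 0" using r \<open>a > 0\<close> by simp
  have "\<exists>w. norm w = t k \<and> norm (f w) \<le> \<mu>" if "k \<le> n" for k
    using small[OF t_gt] t_le[OF that] \<open>r > 0\<close> by simp
  then obtain w where w: "\<And>k. k \<le> n \<Longrightarrow> norm (w k) = t k" "\<And>k. k \<le> n \<Longrightarrow> norm (f (w k)) \<le> \<mu>"
    by metis
  have inj: "inj_on (\<lambda>k. norm (w k)) {..n}"
    using w \<open>a > 0\<close> by (auto simp: inj_on_def t_def)
  have "norm (f z) \<le> 3 * \<mu> * (\<Sum>j\<le>n. \<Prod>k\<in>{..n}-{j}. (norm z + norm (w k)) / \<bar>norm (w j) - norm (w k)\<bar>)
      + exp (sqrt X) * (\<Prod>k\<le>n. (norm z + norm (w k)) / (r / 2))"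
    by (rule lagrange_bound[OF _ hol inj])
       (use w t_le \<open>\<mu> \<ge> 0\<close> M z r \<open>r > 0\<close> in \<open>auto simp: X_def\<close>)
  \<comment> \<open>The scale \<open>a / 8\<close> cancels, and
    \<open>norm z + t k = 4 * a + a / 8 * k^2\<close> becomes \<open>32 + k^2\<close>.\<close>
  also have "(\<Sum>j\<le>n. \<Prod>k\<in>{..n}-{j}. (norm z + norm (w k)) / \<bar>norm (w j) - norm (w k)\<bar>)
      = (\<Sum>j\<le>n. \<Prod>k\<in>{..n}-{j}. (32 + (real k)\<^sup>2) / \<bar>(real j)\<^sup>2 - (real k)\<^sup>2\<bar>)"
  proof (intro sum.cong prod.cong refl)
    fix j k assume jk: "j \<in> {..n}" "k \<in> {..n} - {j}"
    have "norm (w j) - norm (w k) = a / 8 * ((real j)\<^sup>2 - (real k)\<^sup>2)"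
      using jk w by (simp add: t_def algebra_simps)
    then have "\<bar>norm (w j) - norm (w k)\<bar> = a / 8 * \<bar>(real j)\<^sup>2 - (real k)\<^sup>2\<bar>"
      using \<open>a > 0\<close> by (simp only: abs_mult)
    moreover have "norm z + norm (w k) = a / 8 * (32 + (real k)\<^sup>2)"
      using jk w z by (simp add: t_def algebra_simps)
    ultimately show "(norm z + norm (w k)) / \<bar>norm (w j) - norm (w k)\<bar>
        = (32 + (real k)\<^sup>2) / \<bar>(real j)\<^sup>2 - (real k)\<^sup>2\<bar>"
      using \<open>a > 0\<close> by (simp only: mult_divide_mult_cancel_left_if) simp
  qed
  also have "3 * \<mu> * \<dots> \<le> 3 * \<mu> * (2 * exp (2 * 32) * (1 + 2 * 32))"
    using \<open>\<mu> \<ge> 0\<close> by (intro mult_left_mono lebesgue_sum_le) auto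
  also have "(\<Prod>k\<le>n. (norm z + norm (w k)) / (r / 2)) \<le> exp 64 / 4 ^ n"
  proof -
    have fact_le: "(fact n :: real)\<^sup>2 \<le> X ^ n"
    proof -
      have "(fact n :: real)\<^sup>2 \<le> (real n ^ n)\<^sup>2"
        using fact_le_power[of n, where 'a = real] by (intro power_mono) auto
      also have "\<dots> = ((real n)\<^sup>2) ^ n"
        by (simp add: power_mult[symmetric] mult.commute)
      also have "\<dots> \<le> X ^ n"
        using n2 by (intro power_mono) auto
      finally show ?thesis .
    qed
    \<comment> \<open>The ratio of \<open>a / 8\<close> to \<open>r / 2\<close> is
      \<open>1 / (4 * X)\<close>. Of the \<open>n + 1\<close> powers of \<open>1 / X\<close>,
      \<open>n\<close> cancel \<open>(n!)^2 \<le> X ^ n\<close>; the last, with the constant 32 from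
      the node \<open>k = 0\<close>, leaves \<open>8 / X \<le> 1\<close>.\<close>
    have "(\<Prod>k\<le>n. (norm z + norm (w k)) / (r / 2)) = (\<Prod>k\<le>n. (1 / (4 * X)) * (32 + (real k)\<^sup>2))"
      using w z \<open>a > 0\<close> X by (intro prod.cong) (auto simp: t_def field_simps)
    also have "\<dots> = (1 / (4 * X)) ^ Suc n * (\<Prod>k\<le>n. 32 + (real k)\<^sup>2)"
      by (simp only: prod.distrib prod_constant card_atMost)
    also have "\<dots> \<le> (1 / (4 * X)) ^ Suc n * (32 * (exp (2 * 32) * (fact n)\<^sup>2))"
      using X by (intro mult_left_mono prod_add_squares_atMost_le) auto
    also have "\<dots> \<le> (1 / (4 * X)) ^ Suc n * (32 * (exp (2 * 32) * X ^ n))"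
      using X fact_le by (intro mult_left_mono) auto
    also have "\<dots> = (8 / X) * (exp 64 / 4 ^ n)"
      using X by (simp add: power_divide power_mult_distrib field_simps)
    also have "\<dots> \<le> 1 * (exp 64 / 4 ^ n)"
      using X by (intro mult_right_mono) auto
    finally show ?thesis
      by simp
  qed
  \<comment> \<open>Rounding \<open>sqrt X\<close> down to \<open>n\<close> costs one extra factor,
    bounded by 4.\<close>
  also have "exp (sqrt X) * (exp 64 / 4 ^ n) \<le> 4 * exp 64"
  proof -
    have "exp (sqrt X) \<le> exp (real n + 1)"
      using le_n by simp
    also have "\<dots> = exp 1 ^ Suc n"
      by (simp add: exp_of_nat_mult[symmetric] exp_add)
    also have "\<dots> \<le> 4 ^ Suc n"
      using exp_le by (intro power_mono) auto
    finally show ?thesis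
      by (simp add: field_simps)
  qed
  finally show ?thesis
    by (simp add: algebra_simps)
qed

section \<open>The minimum modulus theorem\<close>

text \<open>Positivity of \<open>min_mod f t\<close> is stated explicitly because
  \<open>ln 0\<close> does not stand for minus infinity.\<close>

theorem theorem3:
  fixes f :: "complex \<Rightarrow> complex"
  assumes "transcendental_entire f"
  shows "\<exists>R > 0. \<forall>r \<alpha>. r > 0 \<and> 0 < \<alpha> \<and> \<alpha> < 1/2 \<and>
            ln (max_mod f r) \<le> r powr \<alpha> \<and> r powr (1 - 2*\<alpha>) \<ge> R \<longrightarrow>
            (\<exists>t. r powr (1 - 2*\<alpha>) < t \<and> t < r \<and> min_mod f t > 0 \<and>
                 ln (min_mod f t) > ln (max_mod f (r powr (1 - 2*\<alpha>))) - 2)"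
proof -
  have hol: "f holomorphic_on UNIV"
    using assms by (simp add: transcendental_entire_def)
  \<comment> \<open>The bound \<open>exp 4\<close> serves twice: it forces
    \<open>r / a \<ge> 16\<close>, and it lets the additive 4 be absorbed into
    \<open>4 * max_mod f a\<close>, whence \<open>394 = 390 + 4\<close>.\<close>
  obtain R where "R \<ge> 1"
    and R: "\<And>r. r \<ge> R \<Longrightarrow> max_mod f r \<ge> exp 4 \<and> max_mod f (2 * r) > exp 64 * 394 * max_mod f r"
    using transcendental_max_mod_growth[OF assms, of "exp 64 * 394" "exp 4"] by auto
  have "\<exists>t. r powr (1 - 2*\<alpha>) < t \<and> t < r \<and> min_mod f t > 0 \<and>
                 ln (min_mod f t) > ln (max_mod f (r powr (1 - 2*\<alpha>))) - 2"
    if "r > 0" "0 < \<alpha>" "\<alpha> < 1/2" and ln_M: "ln (max_mod f r) \<le> r powr \<alpha>"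
      and ge_R: "r powr (1 - 2*\<alpha>) \<ge> R" for r \<alpha>
  proof (rule ccontr)
    define a where "a = r powr (1 - 2*\<alpha>)"
    assume contra: "\<not> ?thesis"
    have "a \<ge> 1"
      using ge_R \<open>R \<ge> 1\<close> by (simp add: a_def)
    have "r \<ge> 1"
    proof (rule ccontr)
      assume "\<not> r \<ge> 1"
      then have "a < 1"
        unfolding a_def using that powr_less_mono2[of "1 - 2 * \<alpha>" r 1] by simp
      with \<open>a \<ge> 1\<close> show False by simp
    qed
    have "r / a = (r powr \<alpha>)\<^sup>2"
      using \<open>r > 0\<close> by (simp add: a_def powr_diff power2_eq_square flip: powr_add)
    then have sqrt: "sqrt (r / a) = r powr \<alpha>" and X: "r / a = (r powr \<alpha>)\<^sup>2"
      by simp_all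
    have "a \<le> r"
      unfolding a_def using \<open>r \<ge> 1\<close> that powr_mono[of "1 - 2 * \<alpha>" 1 r] by simp
    have Ma: "max_mod f a \<ge> exp 4" "max_mod f (2 * a) > exp 64 * 394 * max_mod f a"
      using R[of a] ge_R by (auto simp: a_def)
    \<comment> \<open>The growth hypothesis now separates \<open>a\<close> from \<open>r\<close>:
      \<open>4 \<le> ln (max_mod f r) \<le> r powr \<alpha> = sqrt (r / a)\<close>.\<close>
    have "max_mod f r \<ge> exp 4"
      using Ma(1) max_mod_mono[OF hol _ \<open>a \<le> r\<close>] \<open>a \<ge> 1\<close> \<open>r > 0\<close> by simp
    then have Mr: "max_mod f r > 0"
      using less_le_trans[OF exp_gt_zero] by blast
    have "4 \<le> r powr \<alpha>"
      using ln_M ln_ge_iff[OF Mr, of 4] \<open>max_mod f r \<ge> exp 4\<close> by linarith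
    then have "r / a \<ge> 4\<^sup>2"
      unfolding X by (intro power_mono) auto
    then have "16 * a \<le> r"
      using \<open>a \<ge> 1\<close> by (simp add: field_simps)
    have Ma_pos: "max_mod f a > 0"
      using Ma(1) less_le_trans[OF exp_gt_zero] by blast
    have small: "\<exists>w. norm w = t \<and> norm (f w) \<le> max_mod f a" if "a < t" "t < r" for t
    proof -
      have "t \<ge> 0" using that \<open>a \<ge> 1\<close> by simp
      obtain w where w: "norm w = t" "norm (f w) = min_mod f t"
        using min_mod_attained[OF hol \<open>t \<ge> 0\<close>] .
      \<comment> \<open>Otherwise \<open>t\<close> would be a witness for the conclusion, since
        \<open>max_mod f a\<close> is positive and \<open>ln\<close> is increasing.\<close>
      have "min_mod f t \<le> max_mod f a"
      proof (rule ccontr)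
        assume "\<not> min_mod f t \<le> max_mod f a"
        then have "min_mod f t > 0" "ln (max_mod f a) < ln (min_mod f t)"
          using Ma_pos by auto
        with contra that show False
          unfolding a_def[symmetric] by force
      qed
      with w show ?thesis by auto
    qed
    have upper: "norm (f w) \<le> exp (sqrt (r / a))" if "norm w = r" for w
    proof -
      have "norm (f w) \<le> exp (ln (max_mod f r))"
        using norm_le_max_mod[OF hol, of w] that Mr by simp
      then show ?thesis
        using ln_M unfolding sqrt by (meson exp_le_cancel_iff order.trans)
    qed
    obtain z where z: "norm z = 2 * a" "norm (f z) = max_mod f (2 * a)"
      using max_mod_attained[OF hol, of "2 * a"] \<open>a \<ge> 1\<close> by auto
    have "max_mod f (2 * a) \<le> exp 64 * (390 * max_mod f a + 4)"
      using entire_bound_of_small_points[OF hol _ \<open>16 * a \<le> r\<close> small _ upper z(1)] \<open>a \<ge> 1\<close> Ma_pos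
      by (simp add: z(2))
    also have "\<dots> \<le> exp 64 * (390 * max_mod f a + 4 * max_mod f a)"
      using Ma(1) exp_ge_add_one_self[of 4] by (intro mult_left_mono) auto
    finally show False
      using Ma(2) by simp
  qed
  then show ?thesis
    using \<open>R \<ge> 1\<close> by (intro exI[of _ R]) auto
qed

end
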